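(* Let $\mathcal{Y} = \{y \in \mathbb{Z}_{\ge 0}^{|\mathcal{I}|} : \sum_{i \in \mathcal{I}} y_i \le K\}$. Then $$\Big\{(\eta,y) \in \mathbb{R} \times \mathcal{Y} : \eta \le 1 - \prod_{i \in \mathcal{I}} (1-p_i)^{y_i}\Big\} = \Big\{(\eta,y) \in \mathbb{R} \times \mathcal{Y} : \eta \le c(y^* ) + \sum_{i \in \mathcal{I}_{\mathrm{P}}} a_i(y^* ) y_i + \sum_{i \in \mathcal{I}_{\mathrm{F}}} y_i \ \ \forall\, y^* \in \mathcal{Y},\ \ \eta \le 1\Big\}.$$
   Context: $\mathcal{I}$ is a finite set, $K \ge 2$ is an integer, and $p_i \in [0,1]$ for each $i \in \mathcal{I}$. Put $\mathcal{I}_{\mathrm{P}} = \{i \in \mathcal{I} : 0 \le p_i < 1\}$ and $\mathcal{I}_{\mathrm{F}} = \{i \in \mathcal{I} : p_i = 1\}$. The convention $0^0 = 1$ is used. For $y^* \in \mathbb{Z}_{\ge 0}^{|\mathcal{I}|}$ define $$c(y^* ) := 1 - \prod_{i \in \mathcal{I}_{\mathrm{P}}} (1-p_i)^{y_i^*} + \Big(\prod_{\ell \in \mathcal{I}_{\mathrm{P}}} (1-p_\ell)^{y_\ell^*}\Big) \sum_{i \in \mathcal{I}_{\mathrm{P}}} [\ln(1-p_i)]\, y_i^*,$$ $$a_i(y^* ) := -[\ln(1-p_i)] \prod_{\ell \in \mathcal{I}_{\mathrm{P}}} (1-p_\ell)^{y_\ell^*}, \quad i \in \mathcal{I}_{\mathrm{P}}.$$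 *)

theory Defs
  imports Complex_Main "HOL-Library.FuncSet"
begin

text \<open>A vector indexed by the finite set \<open>I\<close> is an extensional function on \<open>I\<close>
  (value \<open>undefined\<close> outside \<open>I\<close>), so that equality of functions is equality of
  vectors and \<open>I\<close> may be empty. In \<open>(1 - p i) ^ y i\<close> the exponent is a natural
  number, so \<open>0 ^ 0 = 1\<close>.\<close>

definition I_P :: "'i set \<Rightarrow> ('i \<Rightarrow> real) \<Rightarrow> 'i set" where
  "I_P I p = {i \<in> I. 0 \<le> p i \<and> p i < 1}"

definition I_F :: "'i set \<Rightarrow> ('i \<Rightarrow> real) \<Rightarrow> 'i set" where
  "I_F I p = {i \<in> I. p i = 1}"

definition feasible :: "'i set \<Rightarrow> nat \<Rightarrow> ('i \<Rightarrow> nat) set" where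
  "feasible I K = {y \<in> I \<rightarrow>\<^sub>E (UNIV :: nat set). (\<Sum>i\<in>I. y i) \<le> K}"

definition cut_const :: "'i set \<Rightarrow> ('i \<Rightarrow> real) \<Rightarrow> ('i \<Rightarrow> nat) \<Rightarrow> real" where
  "cut_const I p ys =
     1 - (\<Prod>i\<in>I_P I p. (1 - p i) ^ ys i)
       + (\<Prod>l\<in>I_P I p. (1 - p l) ^ ys l) * (\<Sum>i\<in>I_P I p. ln (1 - p i) * real (ys i))"

definition cut_coeff :: "'i set \<Rightarrow> ('i \<Rightarrow> real) \<Rightarrow> ('i \<Rightarrow> nat) \<Rightarrow> 'i \<Rightarrow> real" where
  "cut_coeff I p ys i = - ln (1 - p i) * (\<Prod>l\<in>I_P I p. (1 - p l) ^ ys l)"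

end

theory Submission
  imports Defs
begin

text \<open>
  Put \<open>L y = (\<Sum>i\<in>I_P I p. ln (1 - p i) * y i)\<close>. The product over \<open>I_P I p\<close> equals
  \<open>exp (L y)\<close>, and the cut at \<open>ys\<close> is the tangent at \<open>L ys\<close> to the concave function
  \<open>1 - exp\<close>, evaluated at \<open>L y\<close>, plus the number \<open>\<Sum>i\<in>I_F I p. y i\<close> of copies of
  sure items, those with \<open>p i = 1\<close> (\<open>cut_eq_tangent\<close>).

  If no sure item is used by \<open>y\<close>, the full product is \<open>exp (L y)\<close>; every
  tangent lies above the concave function (\<open>cut_ge_concave\<close>) and the tangent at
  \<open>ys = y\<close> touches it (\<open>cut_at_self\<close>), so the cuts together say exactly \<open>\<eta> \<le> 1 - exp (L y)\<close>. If a sure item is used, the full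
  product vanishes, so the nonlinear bound is \<open>\<eta> \<le> 1\<close>; no cut removes a
  point with \<open>\<eta> \<le> 1\<close>, because the sure items add at least \<open>1\<close> to a tangent value
  which is at least \<open>1 - exp (L y) \<ge> 0\<close>.
\<close>

lemma prod_I_P_eq_exp:
  "(\<Prod>i\<in>I_P I p. (1 - p i) ^ y i) = exp (\<Sum>i\<in>I_P I p. ln (1 - p i) * real (y i))"
proof (cases "finite (I_P I p)")
  case True
  have "(1 - p i) ^ y i = exp (ln (1 - p i) * real (y i))" if "i \<in> I_P I p" for i
    using that by (simp add: I_P_def exp_of_nat2_mult)
  then show ?thesis
    using True by (simp add: exp_sum)
qed simp

lemma prod_I_P_le_1: "(\<Prod>i\<in>I_P I p. (1 - p i) ^ y i) \<le> 1"
  by (rule prod_le_1) (auto simp: I_P_def power_le_one)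

text \<open>A sure item has the factor \<open>0 ^ y i\<close>, which is \<open>1\<close> when the item is not
  used and \<open>0\<close> otherwise; hence the sure items act as a switch on the product over
  \<open>I_P I p\<close>.\<close>

lemma prod_split_I_P_I_F:
  assumes "finite I" and "\<And>i. i \<in> I \<Longrightarrow> 0 \<le> p i \<and> p i \<le> 1"
  shows "(\<Prod>i\<in>I. (1 - p i) ^ y i) =
    (if (\<Sum>i\<in>I_F I p. y i) = 0 then \<Prod>i\<in>I_P I p. (1 - p i) ^ y i else 0)"
proof -
  have fin: "finite (I_P I p)" "finite (I_F I p)"
    using assms(1) by (auto simp: I_P_def I_F_def)
  have "I = I_P I p \<union> I_F I p" and "I_P I p \<inter> I_F I p = {}"
    using assms(2) by (fastforce simp: I_P_def I_F_def)+
  then have "(\<Prod>i\<in>I. (1 - p i) ^ y i) =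
      (\<Prod>i\<in>I_P I p. (1 - p i) ^ y i) * (\<Prod>i\<in>I_F I p. (1 - p i) ^ y i)"
    using fin by (metis prod.union_disjoint)
  moreover have "(\<Prod>i\<in>I_F I p. (1 - p i) ^ y i) = (\<Prod>i\<in>I_F I p. 0 ^ y i)"
    by (rule prod.cong) (auto simp: I_F_def)
  moreover have "(\<Prod>i\<in>I_F I p. (0::real) ^ y i) = (if (\<Sum>i\<in>I_F I p. y i) = 0 then 1 else 0)"
    unfolding power_sum [symmetric] by (rule power_0_left)
  ultimately show ?thesis by simp
qed

lemma cut_eq_tangent:
  fixes I :: "'i set" and p :: "'i \<Rightarrow> real" and y ys :: "'i \<Rightarrow> nat"
  defines "L \<equiv> \<lambda>z :: 'i \<Rightarrow> nat. \<Sum>i\<in>I_P I p. ln (1 - p i) * real (z i)"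
  shows "cut_const I p ys + (\<Sum>i\<in>I_P I p. cut_coeff I p ys i * real (y i))
    = 1 - exp (L ys) * (1 + (L y - L ys))"
proof -
  have "(\<Sum>i\<in>I_P I p. cut_coeff I p ys i * real (y i)) = - (exp (L ys) * L y)"
    by (simp add: cut_coeff_def prod_I_P_eq_exp L_def sum_distrib_left sum_distrib_right
        sum_negf mult_ac)
  then show ?thesis
    by (simp add: cut_const_def prod_I_P_eq_exp L_def algebra_simps)
qed

text \<open>The graph of \<open>exp\<close> lies above its tangent at \<open>L ys\<close>, so \<open>1 - exp\<close> lies
  below its own.\<close>

lemma cut_ge_concave:
  "1 - (\<Prod>i\<in>I_P I p. (1 - p i) ^ y i)
    \<le> cut_const I p ys + (\<Sum>i\<in>I_P I p. cut_coeff I p ys i * real (y i))"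
proof -
  have tangent: "exp a * (1 + (b - a)) \<le> exp b" for a b :: real
  proof -
    have "exp a * (1 + (b - a)) \<le> exp a * exp (b - a)"
      by (intro mult_left_mono exp_ge_add_one_self) simp
    then show ?thesis by (simp add: exp_diff)
  qed
  show ?thesis
    unfolding cut_eq_tangent prod_I_P_eq_exp using tangent by (intro diff_left_mono)
qed

lemma cut_at_self:
  "cut_const I p y + (\<Sum>i\<in>I_P I p. cut_coeff I p y i * real (y i))
    = 1 - (\<Prod>i\<in>I_P I p. (1 - p i) ^ y i)"
  unfolding cut_eq_tangent prod_I_P_eq_exp by simp

theorem mainTheorem4:
  fixes I :: "'i set" and K :: nat and p :: "'i \<Rightarrow> real"
  assumes "finite I"
    and "K \<ge> 2"
    and "\<And>i. i \<in> I \<Longrightarrow> 0 \<le> p i \<and> p i \<le> 1"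
  shows "{(\<eta> :: real, y). y \<in> feasible I K \<and> \<eta> \<le> 1 - (\<Prod>i\<in>I. (1 - p i) ^ y i)}
       = {(\<eta> :: real, y). y \<in> feasible I K \<and>
            (\<forall>ys\<in>feasible I K.
               \<eta> \<le> cut_const I p ys + (\<Sum>i\<in>I_P I p. cut_coeff I p ys i * real (y i))
                     + (\<Sum>i\<in>I_F I p. real (y i))) \<and>
            \<eta> \<le> 1}"
proof -
  have "\<eta> \<le> 1 - (\<Prod>i\<in>I. (1 - p i) ^ y i) \<longleftrightarrow>
      (\<forall>ys\<in>feasible I K.
         \<eta> \<le> cut_const I p ys + (\<Sum>i\<in>I_P I p. cut_coeff I p ys i * real (y i))
               + (\<Sum>i\<in>I_F I p. real (y i))) \<and> \<eta> \<le> 1"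
    (is "?bound \<longleftrightarrow> (\<forall>ys\<in>_. ?cut ys) \<and> _")
    if y: "y \<in> feasible I K" for \<eta> :: real and y
  proof -
    let ?Q = "\<Prod>i\<in>I_P I p. (1 - p i) ^ y i"
    have Q: "0 \<le> ?Q" "?Q \<le> 1"
      using prod_I_P_le_1 [where I = I and p = p and y = y] by (simp_all add: prod_I_P_eq_exp)
    have F: "(\<Sum>i\<in>I_F I p. real (y i)) = real (\<Sum>i\<in>I_F I p. y i)"
      by simp
    show ?thesis
    proof (cases "(\<Sum>i\<in>I_F I p. y i) = 0")
      case True
      then have prod: "(\<Prod>i\<in>I. (1 - p i) ^ y i) = ?Q"
        using prod_split_I_P_I_F [where I = I and p = p and y = y] assms by simp
      have "?cut ys" if "?bound" for ys
        using that cut_ge_concave [where I = I and p = p and y = y and ys = ys]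
        unfolding prod F True by simp
      moreover have "?bound" if "?cut y"
        using that unfolding prod F True cut_at_self by simp
      ultimately show ?thesis
        using y Q(1) prod by fastforce
    next
      case False
      then have prod: "(\<Prod>i\<in>I. (1 - p i) ^ y i) = 0"
        using prod_split_I_P_I_F [where I = I and p = p and y = y] assms by simp
      have "1 \<le> (\<Sum>i\<in>I_F I p. real (y i))"
        using False unfolding F by linarith
      then have "?cut ys" if "\<eta> \<le> 1" for ys
        using that cut_ge_concave [where I = I and p = p and y = y and ys = ys] Q(2) by linarith
      then show ?thesis
        unfolding prod by auto
    qed
  qed
  then show ?thesis by blast
qed

end
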